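(* Let $a \in \mathbf{F}_q$ be nonzero, let $n\ge 1$, and let $\sqrt{a}$ be a square root of $a$ in an extension of $\mathbf{F}_q$. Let $f(x) \in \mathbf{F}_q[x]$ be a nontrivial $a$-self reciprocal monic polynomial of degree $2n$ with $f(\sqrt{a})f(-\sqrt{a}) \neq 0$, and let $r$ be the number of irreducible factors of $f(x)$ over $\mathbf{F}_q$, counted with multiplicity. Then $r$ is even if and only if $$(-1)^n a^{n(n-2)} f(\sqrt{a})\, f(-\sqrt{a})$$ is a square in $\mathbf{F}_q$.
   Context: Let $q=p^e$ be an odd prime power and $\mathbf{F}_q$ the finite field with $q$ elements. For a nonzero $a\in\mathbf{F}_q$ and a monic polynomial $f(x)=\sum_{i=0}^N b_i x^i \in \mathbf{F}_q[x]$ of degree $N$ with $f(0)\neq 0$, the $a$-reciprocal of $f$ is $\hat{f}_a(x) := \frac{x^N}{f(0)} f\left(\frac{a}{x}\right) = \frac{1}{b_0}\sum_{i=0}^N b_i a^i x^{N-i}$. A monic polynomial $f(x)$ (with $f(0)\ne 0$) is $a$-self reciprocal if $\hat{f}_a(x)=f(x)$. An $a$-self reciprocal monic polynomial of even degree $N=2m$ is called nontrivial if its constant term is $b_0=a^m$. The product $f(\sqrt{a})f(-\sqrt{a})$ always lies in $\mathbf{F}_q$. The exponent $n(n-2)$ may be negative (when $n=1$), in which case the power is taken in the multiplicative group of $\mathbf{F}_q$. *)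

theory Defs
  imports "HOL-Computational_Algebra.Computational_Algebra" "HOL-Library.Cardinality"
begin

text \<open>
  The field with \<open>q\<close> elements is a type \<open>'a :: {field, finite}\<close>, so that \<open>q = CARD('a)\<close>.
  An extension of it is a type \<open>'b :: field\<close> together with a ring homomorphism
  \<open>h :: 'a \<Rightarrow> 'b\<close>; such a map is automatically injective.
\<close>

definition field_embedding :: "('a::field \<Rightarrow> 'b::field) \<Rightarrow> bool" where
  "field_embedding h \<longleftrightarrow>
     h 1 = 1 \<and> (\<forall>x y. h (x + y) = h x + h y) \<and> (\<forall>x y. h (x * y) = h x * h y)"

text \<open>The polynomial \<open>x ^ N / f 0 * f (a / x)\<close> for \<open>N = degree f\<close>, expanded into its coefficients.\<close>

definition a_reciprocal :: "'a::field \<Rightarrow> 'a poly \<Rightarrow> 'a poly" where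
  "a_reciprocal a f =
     smult (1 / coeff f 0) (\<Sum>i\<le>degree f. monom (coeff f i * a ^ i) (degree f - i))"

definition a_self_reciprocal :: "'a::field \<Rightarrow> 'a poly \<Rightarrow> bool" where
  "a_self_reciprocal a f \<longleftrightarrow> lead_coeff f = 1 \<and> coeff f 0 \<noteq> 0 \<and> a_reciprocal a f = f"

definition nontrivial_a_self_reciprocal :: "'a::field \<Rightarrow> 'a poly \<Rightarrow> bool" where
  "nontrivial_a_self_reciprocal a f \<longleftrightarrow>
     a_self_reciprocal a f \<and> (\<exists>m. degree f = 2 * m \<and> coeff f 0 = a ^ m)"

text \<open>
  The size of \<open>F\<close> is the number of irreducible factors of \<open>f\<close>, counted with multiplicity. Over a
  field it does not depend on \<open>F\<close>, since factorizations are unique up to order and units.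
\<close>

definition irreducible_factorization :: "'a::field poly multiset \<Rightarrow> 'a poly \<Rightarrow> bool" where
  "irreducible_factorization F f \<longleftrightarrow> (\<forall>p \<in># F. irreducible p) \<and> prod_mset F = f"

lemma irreducible_factorization_exists:
  fixes f :: "'a::field poly"
  assumes "degree f > 0"
  shows "\<exists>F. irreducible_factorization F f"
  using assms
proof (induction "degree f" arbitrary: f rule: less_induct)
  case less
  show ?case
  proof (cases "irreducible f")
    case True
    then have "irreducible_factorization {#f#} f"
      by (simp add: irreducible_factorization_def)
    then show ?thesis ..
  next
    case False
    have "f \<noteq> 0"
      using less.prems by auto
    moreover from this have "\<not> is_unit f"
      using less.prems by (simp add: is_unit_iff_degree)
    ultimately obtain g k where gk: "f = g * k" "\<not> is_unit g" "\<not> is_unit k"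
      using False by (auto simp: irreducible_def)
    have nz: "g \<noteq> 0" "k \<noteq> 0"
      using gk(1) \<open>f \<noteq> 0\<close> by auto
    then have pos: "degree g > 0" "degree k > 0"
      using gk by (auto simp: is_unit_iff_degree)
    then have "degree g < degree f" "degree k < degree f"
      using gk(1) nz by (auto simp: degree_mult_eq)
    then obtain G K where "irreducible_factorization G g" "irreducible_factorization K k"
      using less.hyps pos by blast
    then have "irreducible_factorization (G + K) f"
      by (auto simp: irreducible_factorization_def gk(1))
    then show ?thesis ..
  qed
qed

end

theory Submission imports "HOL-Algebra.Algebraic_Closure_Type" "HOL-Number_Theory.Residues" Defs
begin

text \<open>
  Inside an algebraically closed field, an element of \<open>F\<^sub>q\<close> is a square in \<open>F\<^sub>q\<close> iff a square
  root \<open>t\<close> of it satisfies \<open>t ^ q = t\<close> instead of \<open>t ^ q = - t\<close>. For a self-reciprocal \<open>f\<close> of degree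
  \<open>2 * m\<close> not vanishing at \<open>s\<close> and \<open>- s\<close>, where \<open>s ^ 2 = a\<close>, one shows that
  \<open>(-1) ^ m * a ^ (m * m) * f s * f (- s)\<close> has a square root \<open>t\<close> with \<open>t ^ q = (-1) ^ r * t\<close>. Up to
  squares this is multiplicative in \<open>f\<close>, and the \<open>a\<close>-reciprocal permutes the irreducible factors, so
  there are two cases.

  A factor \<open>p\<close> that differs from its reciprocal is paired with it; the value at the product of both
  is \<open>a ^ (N * (N + 1)) * (p s * p (- s) / p 0) ^ 2\<close> for \<open>N = degree p\<close>, whose square root lies in \<open>F\<^sub>q\<close>.

  The roots of a self-reciprocal irreducible \<open>p\<close> form one Frobenius orbit \<open>x\<^sub>i = x ^ q ^ i\<close>, which is
  closed under \<open>y \<mapsto> a / y\<close>. This forces degree \<open>2 * m\<close> and \<open>x\<^sub>i * x\<^bsub>i + m\<^esub> = a\<close>, whence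
  \<open>p s * p (- s) = (- a) ^ m * P ^ 2\<close> for the product \<open>P\<close> of all \<open>x\<^sub>i - x\<^bsub>i + m\<^esub>\<close> with \<open>i < m\<close>. The
  Frobenius map shifts these factors cyclically up to one change of sign, so \<open>P ^ q = - P\<close>.
\<close>

section \<open>The a-reciprocal\<close>

lemma coeff_a_reciprocal:
  "coeff (a_reciprocal a f) j =
     (if j \<le> degree f then coeff f (degree f - j) * a ^ (degree f - j) / coeff f 0 else 0)"
proof -
  let ?N = "degree f"
  have "coeff (\<Sum>i\<le>?N. monom (coeff f i * a ^ i) (?N - i)) j
      = (\<Sum>i\<le>?N. if i = ?N - j \<and> j \<le> ?N then coeff f i * a ^ i else 0)"
    unfolding coeff_sum by (intro sum.cong) auto
  also have "\<dots> = (if j \<le> ?N then coeff f (?N - j) * a ^ (?N - j) else 0)"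
    by (cases "j \<le> ?N") simp_all
  finally show ?thesis
    by (simp add: a_reciprocal_def)
qed

text \<open>Rescaling the variable and reversing the coefficients both respect products; this form
  yields multiplicativity and the evaluation formula.\<close>

lemma a_reciprocal_eq_reflect_poly:
  assumes "a \<noteq> 0"
  shows "a_reciprocal a f = smult (1 / coeff f 0) (reflect_poly (pcompose f [:0, a:]))"
proof -
  have "degree (pcompose f [:0, a:]) = degree f"
    using assms by (simp add: degree_pcompose)
  then show ?thesis
    by (intro poly_eqI)
      (simp add: coeff_a_reciprocal coeff_reflect_poly coeff_pcompose_linear mult_ac)
qed

lemma a_reciprocal_mult:
  assumes "a \<noteq> 0"
  shows "a_reciprocal a (f * g) = a_reciprocal a f * a_reciprocal a g"
  using assms
  by (simp add: a_reciprocal_eq_reflect_poly pcompose_mult reflect_poly_mult coeff_mult mult.commute)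

lemma
  assumes "coeff f 0 \<noteq> 0"
  shows degree_a_reciprocal: "degree (a_reciprocal a f) = degree f"
    and lead_coeff_a_reciprocal: "lead_coeff (a_reciprocal a f) = 1"
proof -
  have *: "coeff (a_reciprocal a f) (degree f) = 1"
    using assms by (simp add: coeff_a_reciprocal)
  show "degree (a_reciprocal a f) = degree f"
  proof (rule antisym)
    show "degree (a_reciprocal a f) \<le> degree f"
      by (rule degree_le) (simp add: coeff_a_reciprocal)
    show "degree f \<le> degree (a_reciprocal a f)"
      using * by (intro le_degree) simp
  qed
  with * show "lead_coeff (a_reciprocal a f) = 1"
    by simp
qed

lemma coeff_0_a_reciprocal: "coeff (a_reciprocal a f) 0 = lead_coeff f * a ^ degree f / coeff f 0"
  by (simp add: coeff_a_reciprocal)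

lemma a_reciprocal_a_reciprocal:
  assumes "a \<noteq> 0" "coeff f 0 \<noteq> 0" "lead_coeff f = 1"
  shows "a_reciprocal a (a_reciprocal a f) = f"
proof (rule poly_eqI)
  fix j
  show "coeff (a_reciprocal a (a_reciprocal a f)) j = coeff f j"
  proof (cases "j \<le> degree f")
    case True
    then have "a ^ degree f = a ^ j * a ^ (degree f - j)"
      by (simp flip: power_add)
    with True assms show ?thesis
      by (simp add: coeff_a_reciprocal degree_a_reciprocal)
  qed (use assms in \<open>simp add: coeff_a_reciprocal degree_a_reciprocal coeff_eq_0\<close>)
qed

text \<open>The multiplicative involution carries a factorization back to one of \<open>f\<close>;
  units are detected by their degree, which is preserved.\<close>

lemma irreducible_a_reciprocal:
  assumes "a \<noteq> 0" "coeff f 0 \<noteq> 0" "lead_coeff f = 1" "irreducible f"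
  shows "irreducible (a_reciprocal a f)"
proof (rule irreducibleI)
  show nz: "a_reciprocal a f \<noteq> 0"
    using lead_coeff_a_reciprocal[OF assms(2), of a] by auto
  show "\<not> is_unit (a_reciprocal a f)"
    using assms nz irreducible_not_unit[OF assms(4)] is_unit_iff_degree[of f]
    by (cases "f = 0") (auto simp: is_unit_iff_degree degree_a_reciprocal)
  fix u v assume uv: "a_reciprocal a f = u * v"
  have "coeff u 0 * coeff v 0 \<noteq> 0"
    using assms coeff_0_a_reciprocal[of a f] by (simp add: uv coeff_mult)
  then have nz: "coeff u 0 \<noteq> 0" "coeff v 0 \<noteq> 0"
    by auto
  have "f = a_reciprocal a u * a_reciprocal a v"
    using assms a_reciprocal_a_reciprocal[of a f] by (simp add: uv a_reciprocal_mult)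
  then have "is_unit (a_reciprocal a u) \<or> is_unit (a_reciprocal a v)"
    by (rule irreducibleD[OF assms(4)])
  moreover have "is_unit w" if "is_unit (a_reciprocal a w)" "coeff w 0 \<noteq> 0" for w
    using that by (cases "a_reciprocal a w = 0"; cases "w = 0")
      (auto simp: is_unit_iff_degree degree_a_reciprocal)
  ultimately show "is_unit u \<or> is_unit v"
    using nz by blast
qed

lemma irreducible_dvd_imp_eq:
  fixes p r :: "'a::field poly"
  assumes "irreducible p" "irreducible r" "p dvd r" "lead_coeff p = 1" "lead_coeff r = 1"
  shows "p = r"
proof -
  obtain c where c: "r = p * c"
    using assms(3) ..
  then have "is_unit c"
    using irreducibleD[OF assms(2) c] irreducible_not_unit[OF assms(1)] by blast
  then obtain d where d: "c = [:d:]"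
    by (auto elim!: is_unit_polyE)
  have "lead_coeff r = lead_coeff p * lead_coeff c"
    unfolding c by (rule lead_coeff_mult)
  with assms(4,5) d have "d = 1"
    by simp
  with c d show ?thesis
    by simp
qed

section \<open>Finite fields and the Frobenius map\<close>

text \<open>Multiplication by a nonzero \<open>c\<close> permutes the nonzero elements; compare
  their products.\<close>

lemma finite_field_power_card:
  fixes c :: "'a::{field, finite}"
  shows "c ^ CARD('a) = c"
proof (cases "c = 0")
  case False
  let ?A = "UNIV - {0 :: 'a}"
  have "(\<Prod>x\<in>?A. c * x) = (\<Prod>x\<in>?A. x)"
    using False by (intro prod.reindex_bij_witness[of _ "\<lambda>x. x / c" "\<lambda>x. c * x"]) auto
  moreover have "(\<Prod>x\<in>?A. c * x) = c ^ card ?A * (\<Prod>x\<in>?A. x)"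
    by (simp add: prod.distrib)
  moreover have "(\<Prod>x\<in>?A. x) \<noteq> 0"
    by simp
  ultimately have "c ^ card ?A = 1"
    by simp
  moreover have "CARD('a) = card ?A + 1"
    using card.remove[of UNIV "0 :: 'a"] by (metis Suc_eq_plus1 UNIV_I finite)
  ultimately show ?thesis
    by (simp only: power_add power_one_right mult_1_left)
qed (simp add: zero_power)

locale finite_field_embedding =
  fixes k :: "'a::{field, finite} \<Rightarrow> 'k::alg_closed_field" and q :: nat
  assumes embedding: "field_embedding k" and card_eq [simp]: "CARD('a) = q"
begin

abbreviation ev :: "'a poly \<Rightarrow> 'k \<Rightarrow> 'k" where "ev p \<equiv> poly (map_poly k p)"

section \<open>Algebraic rules for the embedding and for evaluation\<close>

lemma q_gt_1: "q > 1"
proof -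
  have "card {0, 1 :: 'a} \<le> CARD('a)"
    by (intro card_mono) auto
  then show ?thesis
    by simp
qed

lemma k_1 [simp]: "k 1 = 1"
  and k_add [simp]: "k (x + y) = k x + k y"
  and k_mult [simp]: "k (x * y) = k x * k y"
  using embedding by (simp_all add: field_embedding_def)

lemma k_0 [simp]: "k 0 = 0"
  by (metis add_cancel_right_right k_add)

lemma k_minus [simp]: "k (- x) = - k x"
  using k_add[of x "- x"] by (simp add: add_eq_0_iff)

lemma k_power [simp]: "k (x ^ n) = k x ^ n"
  by (induction n) auto

lemma k_eq_0_iff [simp]: "k x = 0 \<longleftrightarrow> x = 0"
proof
  assume "k x = 0"
  then have "k (x * inverse x) = 0"
    by simp
  then show "x = 0"
    by (cases "x = 0") auto
qed simp

lemma k_divide [simp]: "k (x / y) = k x / k y"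
proof (cases "y = 0")
  case False
  then have "k (x / y) * k y = k x"
    by (simp flip: k_mult)
  with False show ?thesis
    by (simp add: field_simps)
qed simp

lemma inj_k: "inj k"
proof (rule injI)
  fix x y assume "k x = k y"
  then have "k (x - y) = 0"
    using k_add[of "x - y" y] by simp
  then show "x = y"
    by simp
qed

lemma k_eq_iff [simp]: "k x = k y \<longleftrightarrow> x = y"
  using inj_k by (simp add: inj_eq)

lemma k_eq_1_iff [simp]: "k x = 1 \<longleftrightarrow> x = 1"
  using k_eq_iff[of x 1] by (simp del: k_eq_iff)

lemma ev_pCons [simp]: "ev (pCons c p) x = k c + x * ev p x"
  by (simp add: map_poly_pCons)

lemma ev_add [simp]: "ev (p + r) x = ev p x + ev r x"
  by (induction p r rule: poly_induct2) (simp_all add: algebra_simps)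

lemma ev_smult [simp]: "ev (smult c p) x = k c * ev p x"
  by (induction p) (simp_all add: algebra_simps)

lemma ev_mult [simp]: "ev (p * r) x = ev p x * ev r x"
  by (induction p) (simp_all add: algebra_simps)

lemma degree_map_k [simp]: "degree (map_poly k p) = degree p"
  by (rule degree_map_poly) auto

lemma map_k_eq_0_iff [simp]: "map_poly k p = 0 \<longleftrightarrow> p = 0"
  by (simp add: poly_eq_iff coeff_map_poly)

section \<open>The Frobenius map: fixed field and additivity\<close>

lemma k_power_q [simp]: "k c ^ q = k c"
  using finite_field_power_card[of c] by (simp flip: k_power)

lemma card_range_k: "card (range k) = q"
  using inj_k by (simp add: card_image)

text \<open>The polynomial \<open>L\<close> has at most \<open>q\<close> roots, and the
  \<open>q\<close> elements of \<open>range k\<close> are among them.\<close>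

lemma power_q_eq_iff: "x ^ q = x \<longleftrightarrow> x \<in> range k"
proof
  assume x: "x ^ q = x"
  define L :: "'k poly" where "L = monom 1 q - monom 1 1"
  have "coeff L q = 1"
    using q_gt_1 by (simp add: L_def)
  then have "L \<noteq> 0"
    by auto
  have deg: "degree L \<le> q"
    unfolding L_def using q_gt_1 by (intro degree_diff_le) (simp_all add: degree_monom_eq)
  have fin: "finite {y. poly L y = 0}"
    using \<open>L \<noteq> 0\<close> by (rule poly_roots_finite)
  have "range k = {y. poly L y = 0}"
    using card_poly_roots_bound[OF \<open>L \<noteq> 0\<close>] deg
    by (intro card_seteq[OF fin]) (auto simp: L_def poly_monom card_range_k)
  with x show "x \<in> range k"
    by (simp add: L_def poly_monom)
qed auto

lemma power_q_minus_eq_prod: "x ^ q - x = (\<Prod>c\<in>UNIV. x - k c)"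
proof -
  define P where "P = (\<Prod>c\<in>UNIV. [:- k c, 1:])"
  have deg: "degree P = q"
    unfolding P_def by (subst degree_prod_sum_eq) auto
  have "monom 1 q - monom 1 1 = P"
  proof (rule poly_eqI_degree_lead_coeff[where n = q and A = "range k"])
    have "lead_coeff P = 1"
      by (simp add: P_def lead_coeff_prod)
    then show "coeff (monom 1 q - monom 1 1) q = coeff P q"
      unfolding deg using q_gt_1 by simp
    show "degree (monom 1 q - monom 1 1 :: 'k poly) \<le> q"
      using q_gt_1 by (intro degree_diff_le) (simp_all add: degree_monom_eq)
    fix z assume "z \<in> range k"
    then show "poly (monom 1 q - monom 1 1) z = poly P z"
      by (auto simp: P_def poly_prod poly_monom)
  qed (use deg in \<open>simp_all add: card_range_k\<close>)
  then have "poly (monom 1 q - monom 1 1) x = poly P x"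
    by simp
  then show ?thesis
    by (simp add: poly_monom poly_prod P_def)
qed

text \<open>Translation by \<open>c\<close> permutes the linear factors of \<open>x ^ q - x\<close>.
  This special case provides the sample points for general additivity.\<close>

lemma power_q_add_k: "(x + k c) ^ q = x ^ q + k c"
proof -
  have "(\<Prod>d\<in>UNIV. x + k c - k d) = (\<Prod>d\<in>UNIV. x - k d)"
    by (intro prod.reindex_bij_witness[of _ "\<lambda>d. d + c" "\<lambda>d. d - c"])
       (auto simp: algebra_simps simp flip: k_add)
  then show ?thesis
    by (simp flip: power_q_minus_eq_prod add: algebra_simps)
qed

text \<open>
  Both sides are monic polynomials of degree \<open>q\<close> in \<open>x\<close> which agree on the image of \<open>k\<close>;
  this way it is not necessary to know that \<open>q\<close> is a prime power.
\<close>

lemma frobenius_add: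
  fixes x y :: 'k
  shows "(x + y) ^ q = x ^ q + y ^ q"
proof -
  have "[:y, 1:] ^ q = monom 1 q + [:y ^ q:]"
  proof (rule poly_eqI_degree_lead_coeff[where n = q and A = "range k"])
    show "coeff ([:y, 1:] ^ q) q = coeff (monom 1 q + [:y ^ q:]) q"
      using q_gt_1 by (simp add: coeff_linear_power coeff_pCons split: nat.splits)
    show "degree (monom 1 q + [:y ^ q:]) \<le> q"
      by (intro degree_add_le degree_monom_le) auto
  qed (auto simp: card_range_k poly_monom degree_linear_power power_q_add_k)
  then have "poly ([:y, 1:] ^ q) x = poly (monom 1 q + [:y ^ q:]) x"
    by simp
  then show ?thesis
    by (simp add: poly_monom add.commute)
qed

lemma frobenius_minus: "(- x :: 'k) ^ q = - (x ^ q)"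
  using frobenius_add[of x "- x"] q_gt_1 by (simp add: zero_power add_eq_0_iff)

lemma frobenius_diff: "(x - y :: 'k) ^ q = x ^ q - y ^ q"
  using frobenius_add[of x "- y"] by (simp add: frobenius_minus)

lemma frobenius_sum: "(\<Sum>i\<in>A. f i :: 'k) ^ q = (\<Sum>i\<in>A. f i ^ q)"
  using q_gt_1 by (induction A rule: infinite_finite_induct) (simp_all add: zero_power frobenius_add)

lemma frobenius_eq_iff: "x ^ q = y ^ q \<longleftrightarrow> x = (y :: 'k)"
proof
  assume "x ^ q = y ^ q"
  then have "(x - y) ^ q = 0"
    by (simp add: frobenius_diff)
  then show "x = y"
    by simp
qed simp

lemma frobenius_ev: "ev p x ^ q = ev p (x ^ q)"
  by (induction p) (use q_gt_1 in \<open>simp_all add: frobenius_add power_mult_distrib zero_power\<close>)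

lemma frobenius_Suc: "(x :: 'k) ^ q ^ Suc n = (x ^ q ^ n) ^ q"
  by (simp only: power_Suc2 power_mult)

lemma frobenius_iter_eq_iff: "x ^ q ^ n = y ^ q ^ n \<longleftrightarrow> x = (y :: 'k)"
proof (induction n)
  case (Suc n)
  then show ?case
    by (simp only: frobenius_Suc frobenius_eq_iff)
qed simp

lemma frobenius_iter_ev_0: "ev p x = 0 \<Longrightarrow> ev p (x ^ q ^ n) = 0"
proof (induction n)
  case (Suc n)
  have "ev p (x ^ q ^ Suc n) = ev p (x ^ q ^ n) ^ q"
    by (simp only: frobenius_ev frobenius_Suc)
  with Suc q_gt_1 show ?case
    by (simp add: zero_power)
qed simp

lemma zero_power_q [simp]: "(0 :: 'k) ^ q = 0"
  using q_gt_1 by (simp add: zero_power)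

lemma frobenius_map_poly_mult:
  "map_poly (\<lambda>x. x ^ q) (p * r :: 'k poly) = map_poly (\<lambda>x. x ^ q) p * map_poly (\<lambda>x. x ^ q) r"
proof (rule poly_eqI)
  fix n
  show "coeff (map_poly (\<lambda>x. x ^ q) (p * r)) n
      = coeff (map_poly (\<lambda>x. x ^ q) p * map_poly (\<lambda>x. x ^ q) r) n"
    by (simp only: coeff_map_poly[where f = "\<lambda>x. x ^ q", OF zero_power_q] coeff_mult
        frobenius_sum power_mult_distrib)
qed

lemma frobenius_map_poly_prod:
  "map_poly (\<lambda>x. x ^ q) (\<Prod>i\<in>A. f i :: 'k poly) = (\<Prod>i\<in>A. map_poly (\<lambda>x. x ^ q) (f i))"
  by (induction A rule: infinite_finite_induct) (simp_all add: frobenius_map_poly_mult)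

section \<open>Roots of irreducible polynomials\<close>

lemma irreducible_imp_root:
  assumes "irreducible p"
  obtains x where "ev p x = 0"
proof -
  have "degree p > 0"
    using assms is_unit_iff_degree[of p] irreducible_not_unit[of p] by (cases "p = 0") auto
  then show ?thesis
    using alg_closed_imp_poly_has_root[of "map_poly k p"] that by auto
qed

text \<open>By division with remainder, a nonzero polynomial of least degree vanishing at
  \<open>x\<close> divides all others that vanish there; \<open>p\<close> is associated to
  it.\<close>

lemma irreducible_dvd_if_common_root:
  assumes "irreducible p" "ev p x = 0" "ev g x = 0"
  shows "p dvd g"
proof -
  define S where "S = {m. m \<noteq> 0 \<and> ev m x = 0}"
  have "p \<in> S"
    using assms by (auto simp: S_def)
  then obtain m where m: "m \<in> S" "\<And>w. w \<in> S \<Longrightarrow> degree m \<le> degree w"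
    using ex_has_least_nat[of "\<lambda>m. m \<in> S" p degree] by blast
  have dvd: "m dvd w" if "ev w x = 0" for w
  proof (rule ccontr)
    assume "\<not> m dvd w"
    then have "w mod m \<noteq> 0"
      by (simp add: dvd_eq_mod_eq_0)
    moreover have "ev (w mod m) x = 0"
      using that m(1) ev_add[of "w div m * m" "w mod m" x] by (simp add: S_def)
    ultimately have "degree m \<le> degree (w mod m)"
      by (intro m(2)) (simp add: S_def)
    with degree_mod_less'[of m w] \<open>w mod m \<noteq> 0\<close> m(1) show False
      by (simp add: S_def)
  qed
  have "\<not> is_unit m"
  proof
    assume "is_unit m"
    with m(1) show False
      by (auto simp: S_def elim!: is_unit_polyE)
  qed
  moreover obtain c where c: "p = m * c"
    using dvd[OF assms(2)] ..
  ultimately have "is_unit c"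
    using irreducibleD[OF assms(1) c] by blast
  then have "p dvd m"
    unfolding c by (simp add: mult_unit_dvd_iff)
  with dvd[OF assms(3)] show ?thesis
    using dvd_trans by blast
qed

text \<open>The product over the orbit of a root has coefficients in F_q, so \<open>p\<close>
  divides it; the orbit consists of distinct roots of \<open>p\<close>, so the degrees
  agree.\<close>

lemma irreducible_splits_into_frobenius_orbit:
  assumes "irreducible p" "lead_coeff p = 1"
  obtains x where
    "map_poly k p = (\<Prod>i<degree p. [:- (x ^ q ^ i), 1:])"
    "x ^ q ^ degree p = x"
    "\<And>i. 0 < i \<Longrightarrow> i < degree p \<Longrightarrow> x ^ q ^ i \<noteq> x"
proof -
  obtain x where x: "ev p x = 0"
    using assms(1) by (rule irreducible_imp_root)
  have "map_poly k p \<noteq> 0"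
    using assms(2) by auto
  then have fin: "finite {y. ev p y = 0}"
    by (rule poly_roots_finite)
  have period: "x ^ q ^ (j - i) = x" if "i < j" "x ^ q ^ i = x ^ q ^ j" for i j
  proof -
    have "x ^ q ^ j = (x ^ q ^ (j - i)) ^ q ^ i"
      using that(1) by (simp flip: power_mult power_add)
    with that(2) show ?thesis
      by (metis frobenius_iter_eq_iff)
  qed
  \<comment> \<open>All iterates are among the finitely many roots of \<open>p\<close>, so they
    repeat; by injectivity of Frobenius the sequence is then purely periodic.\<close>
  have "\<not> inj_on (\<lambda>i. x ^ q ^ i) UNIV"
  proof
    assume "inj_on (\<lambda>i. x ^ q ^ i) UNIV"
    moreover have "range (\<lambda>i. x ^ q ^ i) \<subseteq> {y. ev p y = 0}"
      using frobenius_iter_ev_0[OF x] by auto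
    ultimately show False
      using fin by (meson finite_imageD finite_subset infinite_UNIV_nat)
  qed
  then obtain i j where "i < j" "x ^ q ^ i = x ^ q ^ j"
    by (metis (mono_tags, lifting) inj_onI linorder_neqE_nat)
  then have ex: "\<exists>d. 0 < d \<and> x ^ q ^ d = x"
    using period by (intro exI[of _ "j - i"]) simp
  define d where "d = (LEAST d. 0 < d \<and> x ^ q ^ d = x)"
  have d: "0 < d" "x ^ q ^ d = x"
    using LeastI_ex[OF ex] by (auto simp: d_def)
  have d_least: "x ^ q ^ i \<noteq> x" if "0 < i" "i < d" for i
    using not_less_Least[of i "\<lambda>d. 0 < d \<and> x ^ q ^ d = x"] that by (auto simp: d_def)
  have inj: "inj_on (\<lambda>i. x ^ q ^ i) {..<d}"
  proof (rule linorder_inj_onI)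
    fix i j assume "i < j" "i \<in> {..<d}" "j \<in> {..<d}"
    then show "x ^ q ^ i \<noteq> x ^ q ^ j"
      using period[of i j] d_least[of "j - i"] by auto
  qed auto
  define Q where "Q = (\<Prod>i<d. [:- (x ^ q ^ i), 1:])"
  have deg_Q: "degree Q = d"
    unfolding Q_def by (subst degree_prod_sum_eq) auto
  have lead_Q: "lead_coeff Q = 1"
    by (simp add: Q_def lead_coeff_prod)
  have "map_poly (\<lambda>y. y ^ q) Q = (\<Prod>i<d. [:- (x ^ q ^ Suc i), 1:])"
    unfolding Q_def frobenius_map_poly_prod frobenius_Suc
    by (simp add: map_poly_pCons frobenius_minus)
  also have "\<dots> = Q"
  proof -
    let ?R = "\<Prod>i<d. [:- (x ^ q ^ Suc i), 1:]"
    \<comment> \<open>The product of \<open>Suc d\<close> factors is split at its first and at its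
      last factor, both of which belong to \<open>x\<close>.\<close>
    have "[:- (x ^ q ^ 0), 1:] * (\<Prod>i<d. [:- (x ^ q ^ Suc i), 1:])
        = (\<Prod>i<Suc d. [:- (x ^ q ^ i), 1:])"
      by (rule prod.lessThan_Suc_shift[symmetric])
    also have "\<dots> = Q * [:- x, 1:]"
      unfolding Q_def prod.lessThan_Suc d(2) ..
    finally have "[:- x, 1:] * ?R = [:- x, 1:] * Q"
      by (simp only: power_0 power_one_right mult.commute[of Q])
    then show ?thesis
      by (rule mult_left_cancel[THEN iffD1, rotated]) simp
  qed
  finally have "coeff (map_poly (\<lambda>y. y ^ q) Q) i = coeff Q i" for i
    by simp
  then have "coeff Q i ^ q = coeff Q i" for i
    by (simp add: coeff_map_poly)
  then have coeffs: "coeff Q i \<in> range k" for i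
    by (simp add: power_q_eq_iff)
  have inv_0: "inv_into UNIV k 0 = 0"
    using inj_k by (rule inv_f_eq) simp
  define g where "g = map_poly (inv_into UNIV k) Q"
  have g: "map_poly k g = Q"
    by (rule poly_eqI) (simp add: g_def coeff_map_poly inv_0 f_inv_into_f coeffs)
  have "g \<noteq> 0"
    using g lead_Q by auto
  have "degree g = d"
    using deg_Q by (simp flip: g)
  have "ev g x = 0"
    using d(1) by (simp only: g) (auto simp: Q_def poly_prod intro!: bexI[of _ 0])
  then have "p dvd g"
    using assms(1) x by (rule irreducible_dvd_if_common_root[rotated 2])
  then obtain c where c: "g = p * c" ..
  have "card ((\<lambda>i. x ^ q ^ i) ` {..<d}) \<le> card {y. ev p y = 0}"
    using frobenius_iter_ev_0[OF x] by (intro card_mono fin) auto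
  also have "\<dots> \<le> degree p"
    using card_poly_roots_bound[OF \<open>map_poly k p \<noteq> 0\<close>] by simp
  finally have "d \<le> degree p"
    using inj by (simp add: card_image)
  moreover have "degree g = degree p + degree c"
    using c \<open>g \<noteq> 0\<close> by (auto simp: degree_mult_eq)
  ultimately have "degree c = 0" and deg_p: "degree p = d"
    using \<open>degree g = d\<close> by auto
  moreover have "lead_coeff g = 1"
    using lead_Q by (simp flip: g add: coeff_map_poly)
  ultimately have "c = 1"
    using c assms(2) by (auto simp: lead_coeff_mult elim!: degree_eq_zeroE)
  with c g have "map_poly k p = Q"
    by simp
  with that[of x] d d_least deg_p show ?thesis
    by (simp add: Q_def)
qed

end

section \<open>The parity of the number of irreducible factors\<close>

lemma prod_lessThan_add:
  "(\<Prod>i<m + n :: nat. f i :: 'a::comm_monoid_mult) = (\<Prod>i<m. f i) * (\<Prod>i<n. f (i + m))"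
  by (induction n) (simp_all add: add.commute mult.assoc)

locale reciprocal_sqrt = finite_field_embedding k q
  for k :: "'a::{field, finite} \<Rightarrow> 'k::alg_closed_field" and q :: nat +
  fixes a :: 'a and s :: 'k
  assumes a_nonzero: "a \<noteq> 0" and s_square: "s ^ 2 = k a" and odd_q: "odd q"
begin

definition pm :: "'a poly \<Rightarrow> 'k" where "pm f = ev f s * ev f (- s)"

text \<open>
  The exponent \<open>m * m\<close> differs from \<open>m * (m - 2)\<close> by an even number, and is never negative.
\<close>

definition parity_sqrt :: "'a poly \<Rightarrow> nat \<Rightarrow> nat \<Rightarrow> bool" where
  "parity_sqrt f m r \<longleftrightarrow> degree f = 2 * m \<and>
     (\<exists>t. t ^ 2 = k ((-1) ^ m * a ^ (m * m)) * pm f \<and> t ^ q = (-1) ^ r * t)"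

lemma pm_mult: "pm (f * g) = pm f * pm g"
  by (simp add: pm_def mult_ac)

text \<open>Frobenius fixes or swaps \<open>s\<close> and \<open>- s\<close>, as their square lies
  in F_q.\<close>

lemma pm_frobenius: "pm f ^ q = pm f"
proof -
  have "(s ^ q) ^ 2 = s ^ 2"
    using power_mult[of s q 2] power_mult[of s 2 q] by (simp add: s_square mult.commute)
  then consider "s ^ q = s" | "s ^ q = - s"
    by (auto simp: power2_eq_iff)
  then show ?thesis
    by cases (simp_all add: pm_def power_mult_distrib frobenius_ev frobenius_minus)
qed

text \<open>This separates \<open>t ^ q = t\<close> from \<open>t ^ q = - t\<close>. In
  characteristic 2 the odd number \<open>q\<close> would be even.\<close>

lemma one_neq_minus_one: "(1 :: 'k) \<noteq> - 1"
proof
  assume "(1 :: 'k) = - 1"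
  then have "k (1 + 1) = 0"
    by (metis add.right_inverse k_1 k_add)
  then have "of_nat 2 = (0 :: 'a)"
    by (simp del: k_add)
  then have "CHAR('a) dvd 2"
    by (simp only: of_nat_eq_0_iff_char_dvd)
  moreover have "CHAR('a) \<noteq> 1"
    by simp
  ultimately have "CHAR('a) = 2"
    using primes_dvd_imp_eq prime_nat_iff two_is_prime_nat by blast
  with odd_q show False
    using CHAR_dvd_CARD[where ?'a = 'a] by simp
qed

lemma ev_a_reciprocal:
  assumes "x \<noteq> 0"
  shows "ev (a_reciprocal a f) x = x ^ degree f * ev f (k a / x) / k (coeff f 0)"
proof -
  have "map_poly k (a_reciprocal a f) = a_reciprocal (k a) (map_poly k f)"
    by (intro poly_eqI) (simp add: coeff_map_poly coeff_a_reciprocal)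
  also have "poly \<dots> x = x ^ degree f * ev f (k a / x) / k (coeff f 0)"
    using assms a_nonzero
    by (simp add: a_reciprocal_eq_reflect_poly poly_reflect_poly_nz poly_pcompose degree_pcompose
        coeff_map_poly field_simps)
  finally show ?thesis .
qed

lemma parity_sqrt_1: "parity_sqrt 1 0 0"
  unfolding parity_sqrt_def by (auto simp: pm_def intro: exI[of _ 1])

text \<open>The cross term in \<open>(m + n) * (m + n)\<close> is twice \<open>m * n\<close>, so the
  two roots are multiplied and adjusted by \<open>k (a ^ (m * n))\<close>, which Frobenius
  fixes.\<close>

lemma parity_sqrt_mult:
  assumes "parity_sqrt f m r" "parity_sqrt g n l" "f \<noteq> 0" "g \<noteq> 0"
  shows "parity_sqrt (f * g) (m + n) (r + l)"
proof -
  obtain t where t: "t ^ 2 = k ((-1) ^ m * a ^ (m * m)) * pm f" "t ^ q = (-1) ^ r * t"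
    using assms(1) by (auto simp: parity_sqrt_def)
  obtain u where u: "u ^ 2 = k ((-1) ^ n * a ^ (n * n)) * pm g" "u ^ q = (-1) ^ l * u"
    using assms(2) by (auto simp: parity_sqrt_def)
  have "(t * u * k (a ^ (m * n))) ^ 2
      = k ((-1) ^ (m + n) * a ^ ((m + n) * (m + n))) * pm (f * g)"
    unfolding power_mult_distrib t(1) u(1) pm_mult
    by (simp add: power_add power2_eq_square algebra_simps)
  moreover have "(t * u * k (a ^ (m * n))) ^ q = (-1) ^ (r + l) * (t * u * k (a ^ (m * n)))"
    unfolding power_mult_distrib t(2) u(2) k_power_q by (simp add: power_add)
  ultimately show ?thesis
    using assms by (auto simp: parity_sqrt_def degree_mult_eq)
qed

text \<open>Both kinds of factors contribute \<open>(- k a) ^ m\<close> times a square. With the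
  normalization the signs cancel and the exponent \<open>m * m + m\<close> is even.\<close>

lemma sign_power_is_square:
  obtains e where "k ((-1) ^ m * a ^ (m * m)) * (- k a) ^ m = k (a ^ e) ^ 2"
proof -
  have "even (m * m + m)"
    by simp
  then obtain e where e: "m * m + m = e * 2"
    by (metis evenE mult.commute)
  have "k ((-1) ^ m * a ^ (m * m)) * (- k a) ^ m = ((-1) * (-1)) ^ m * k a ^ (m * m + m)"
    unfolding power_minus[of "k a"] power_mult_distrib by (simp add: power_add)
  also have "\<dots> = k (a ^ e) ^ 2"
    unfolding e power_mult by simp
  finally show ?thesis
    using that by blast
qed

lemma parity_sqrt_reciprocal_pair:
  assumes "coeff p 0 \<noteq> 0"
  shows "parity_sqrt (p * a_reciprocal a p) (degree p) 2"
proof -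
  define N where "N = degree p"
  obtain e where e: "k ((-1) ^ N * a ^ (N * N)) * (- k a) ^ N = k (a ^ e) ^ 2"
    by (rule sign_power_is_square)
  have s_nz: "s \<noteq> 0"
    using s_square a_nonzero by auto
  \<comment> \<open>The points \<open>s\<close> and \<open>- s\<close> are fixed by
    \<open>y \<mapsto> a / y\<close>, so up to the constant term the reciprocal takes there the
    values of \<open>p\<close> times \<open>s ^ N\<close> and \<open>(- s) ^ N\<close>.\<close>
  have "k a / s = s"
    using s_nz s_square by (simp add: field_simps power2_eq_square)
  then have pm_rec: "pm (a_reciprocal a p) = (- k a) ^ N * pm p / k (coeff p 0) ^ 2"
    using s_nz s_square
    by (simp add: pm_def ev_a_reciprocal N_def power2_eq_square flip: power_mult_distrib)
  define c where "c = a ^ e / coeff p 0"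
  have "(k c * pm p) ^ 2 = k (a ^ e) ^ 2 * pm p ^ 2 / k (coeff p 0) ^ 2"
    by (simp add: c_def power_mult_distrib power_divide)
  also have "\<dots> = k ((-1) ^ N * a ^ (N * N)) * pm (p * a_reciprocal a p)"
    unfolding pm_mult pm_rec e[symmetric] by (simp add: power2_eq_square)
  finally have "(k c * pm p) ^ 2 = k ((-1) ^ N * a ^ (N * N)) * pm (p * a_reciprocal a p)" .
  moreover have "(k c * pm p) ^ q = (-1) ^ 2 * (k c * pm p)"
    by (simp only: power_mult_distrib k_power_q pm_frobenius) simp
  moreover have "degree (p * a_reciprocal a p) = 2 * N"
  proof -
    have "p \<noteq> 0" "a_reciprocal a p \<noteq> 0"
      using assms lead_coeff_a_reciprocal[OF assms, of a] by auto
    with assms show ?thesis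
      by (simp add: degree_mult_eq degree_a_reciprocal N_def)
  qed
  ultimately show ?thesis
    unfolding parity_sqrt_def N_def by blast
qed

lemma parity_sqrt_irreducible_self_reciprocal:
  assumes "irreducible p" "lead_coeff p = 1" "coeff p 0 \<noteq> 0" "a_reciprocal a p = p" "pm p \<noteq> 0"
  shows "\<exists>m. parity_sqrt p m 1"
proof -
  define d where "d = degree p"
  obtain x where x: "map_poly k p = (\<Prod>i<d. [:- (x ^ q ^ i), 1:])" "x ^ q ^ d = x"
      "\<And>i. 0 < i \<Longrightarrow> i < d \<Longrightarrow> x ^ q ^ i \<noteq> x"
    using irreducible_splits_into_frobenius_orbit[OF assms(1,2)] unfolding d_def by metis
  define al where "al = (\<lambda>i. x ^ q ^ i)"
  have al_add: "al (i + j) = al i ^ q ^ j" for i j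
    by (simp add: al_def power_add power_mult)
  have al_0: "al 0 = x" and al_d: "al d = x"
    using x(2) by (simp_all add: al_def)
  have al_neq: "al i \<noteq> x" if "0 < i" "i < d" for i
    using x(3) that by (simp add: al_def)
  have ev_p: "ev p y = (\<Prod>i<d. y - al i)" for y
    by (simp add: x(1) al_def poly_prod)
  have "d > 0"
    using assms(1) irreducible_not_unit[of p] is_unit_iff_degree[of p]
    by (cases "p = 0") (auto simp: d_def)
  then have "ev p x = 0"
    using al_0 by (auto simp: ev_p intro!: bexI[of _ 0])
  moreover have "ev p 0 = k (coeff p 0)"
    by (simp add: poly_0_coeff_0 coeff_map_poly)
  ultimately have "x \<noteq> 0"
    using assms(3) by auto
  \<comment> \<open>Self-reciprocity makes \<open>k a / x\<close> a root too, hence a member of the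
    orbit.\<close>
  then have "ev p (k a / x) = 0"
    using ev_a_reciprocal[of x p] assms(3,4) \<open>ev p x = 0\<close> by simp
  then obtain j where j: "j < d" "k a / x = al j"
    by (auto simp: ev_p)
  then have prod_0: "al j * x = k a"
    using \<open>x \<noteq> 0\<close> by (auto simp: field_simps)
  have k_iter: "k b ^ q ^ i = k b" for b i
    by (induction i) (simp_all add: frobenius_Suc del: power_Suc)
  have prod_i: "al (i + j) * al i = k a" for i
  proof -
    have "al (i + j) * al i = (al j * x) ^ q ^ i"
      using al_add[of j i] al_add[of 0 i] by (simp add: power_mult_distrib al_0 add.commute)
    then show ?thesis
      by (simp add: prod_0 k_iter)
  qed
  have "al j \<noteq> 0"
    using prod_0 a_nonzero by auto
  then have al_2j: "al (j + j) = x"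
    using prod_i[of j] prod_0 by (metis mult.commute mult_left_cancel)
  \<comment> \<open>Otherwise \<open>x\<close> would be \<open>s\<close> or \<open>- s\<close>,
    where \<open>p\<close> does not vanish.\<close>
  have "j \<noteq> 0"
  proof
    assume "j = 0"
    then have "x ^ 2 = s ^ 2"
      unfolding s_square using prod_0 by (simp add: al_0 power2_eq_square)
    then have "x = s \<or> x = - s"
      by (simp add: power2_eq_iff)
    then show False
      using \<open>ev p x = 0\<close> assms(5) by (auto simp: pm_def)
  qed
  \<comment> \<open>The index \<open>j + j\<close> returns to \<open>x\<close> and lies strictly
    between 0 and \<open>d + d\<close>; only the exact period \<open>d\<close> does so.\<close>
  have "d = j + j"
  proof (rule antisym)
    show "d \<le> j + j"
      using al_neq[of "j + j"] al_2j \<open>j \<noteq> 0\<close> by force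
    then have "al (j + j) = al (d + (j + j - d))"
      by simp
    also have "\<dots> = al (0 + (j + j - d))"
      unfolding al_add[of d] al_add[of 0] al_d al_0 ..
    finally have "al (j + j - d) = x"
      using al_2j by simp
    then show "j + j \<le> d"
      using al_neq[of "j + j - d"] j(1) by force
  qed
  define g where "g = (\<lambda>i. al i - al (i + j))"
  define P where "P = (\<Prod>i<j. g i)"
  \<comment> \<open>Each root \<open>y\<close> contributes \<open>y ^ 2 - k a\<close>. Since
    \<open>al i\<close> and \<open>al (i + j)\<close> have product \<open>k a\<close>, their
    contributions are \<open>al i * g i\<close> and \<open>- al (i + j) * g i\<close>.\<close>
  have "pm p = (\<Prod>i<j + j. al i ^ 2 - k a)"
    unfolding pm_def ev_p \<open>d = j + j\<close> prod.distrib[symmetric]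
    by (intro prod.cong) (simp_all add: algebra_simps power2_eq_square flip: s_square)
  also have "\<dots> = (\<Prod>i<j. (al i ^ 2 - k a) * (al (i + j) ^ 2 - k a))"
    by (simp add: prod_lessThan_add prod.distrib)
  also have "\<dots> = (\<Prod>i<j. - k a * g i ^ 2)"
  proof (rule prod.cong)
    fix i
    show "(al i ^ 2 - k a) * (al (i + j) ^ 2 - k a) = - k a * g i ^ 2"
      unfolding g_def prod_i[of i, symmetric] by (simp add: power2_eq_square algebra_simps)
  qed simp
  finally have pm_p: "pm p = (- k a) ^ j * P ^ 2"
    by (simp only: prod.distrib P_def prod_power_distrib prod_constant card_lessThan)
  \<comment> \<open>Frobenius sends \<open>g i\<close> to \<open>g (Suc i)\<close>: the factor
    \<open>g 0\<close> leaves at the front and returns at the end as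
    \<open>g j = - g 0\<close>.\<close>
  have "g 0 * P ^ q = g 0 * (- P)"
  proof -
    have "P ^ q = (\<Prod>i<j. g (Suc i))"
      using al_add[of _ 1] 
      by (simp add: P_def g_def prod_power_distrib frobenius_diff)
    then have "g 0 * P ^ q = (\<Prod>i<Suc j. g i)"
      by (simp only: prod.lessThan_Suc_shift)
    also have "\<dots> = P * g j"
      by (simp add: P_def)
    also have "g j = - g 0"
      by (simp add: g_def al_2j al_0)
    finally show ?thesis
      by simp
  qed
  moreover have "g 0 \<noteq> 0"
    using al_neq[of j] j(1) \<open>j \<noteq> 0\<close> by (simp add: g_def al_0)
  ultimately have P_q: "P ^ q = - P"
    using mult_left_cancel by blast
  obtain e where e: "k ((-1) ^ j * a ^ (j * j)) * (- k a) ^ j = k (a ^ e) ^ 2"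
    by (rule sign_power_is_square)
  have "(k (a ^ e) * P) ^ 2 = k ((-1) ^ j * a ^ (j * j)) * pm p"
    unfolding pm_p power_mult_distrib e[symmetric] by (simp only: mult.assoc)
  moreover have "(k (a ^ e) * P) ^ q = (-1) ^ 1 * (k (a ^ e) * P)"
    unfolding power_mult_distrib k_power_q P_q by simp
  ultimately have "parity_sqrt p j 1"
    using \<open>d = j + j\<close> unfolding parity_sqrt_def d_def by auto
  then show ?thesis ..
qed

text \<open>Strong induction, since a step removes one self-reciprocal factor or a pair of factors;
  by cancellation the rest is again self-reciprocal.\<close>

lemma parity_sqrt_size:
  assumes "\<And>p. p \<in># F \<Longrightarrow> irreducible p \<and> lead_coeff p = 1"
    and "f = prod_mset F" "coeff f 0 \<noteq> 0" "a_reciprocal a f = f" "pm f \<noteq> 0"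
  shows "\<exists>m. parity_sqrt f m (size F)"
  using assms
proof (induction "size F" arbitrary: F f rule: less_induct)
  case less
  show ?case
  proof (cases F)
    case empty
    then show ?thesis
      using less.prems parity_sqrt_1 by auto
  next
    case (add p G)
    have p: "irreducible p" "lead_coeff p = 1"
      using less.prems(1) add by auto
    have f: "f = p * prod_mset G"
      using less.prems(2) add by simp
    have p0: "coeff p 0 \<noteq> 0" and G0: "coeff (prod_mset G) 0 \<noteq> 0"
      using less.prems(3) by (auto simp: f coeff_mult)
    define p' where "p' = a_reciprocal a p"
    have p': "irreducible p'" "lead_coeff p' = 1" "coeff p' 0 \<noteq> 0" "a_reciprocal a p' = p"
      using p p0 a_nonzero unfolding p'_def
      by (simp_all add: irreducible_a_reciprocal lead_coeff_a_reciprocal a_reciprocal_a_reciprocal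
          coeff_0_a_reciprocal)
    have nz: "p \<noteq> 0" "p' \<noteq> 0" "prod_mset G \<noteq> 0"
      using p0 p'(3) G0 by (metis coeff_0)+
    have rec_f: "p' * a_reciprocal a (prod_mset G) = p * prod_mset G"
      using less.prems(4) a_nonzero by (simp add: f a_reciprocal_mult p'_def)
    show ?thesis
    proof (cases "p' = p")
      case True
      with rec_f nz have "a_reciprocal a (prod_mset G) = prod_mset G"
        by simp
      moreover have "pm p \<noteq> 0" "pm (prod_mset G) \<noteq> 0"
        using less.prems(5) by (auto simp: f pm_mult)
      ultimately obtain m where m: "parity_sqrt (prod_mset G) m (size G)"
        using less.hyps[of G "prod_mset G"] less.prems(1) add G0 by auto
      obtain l where "parity_sqrt p l 1"
        using parity_sqrt_irreducible_self_reciprocal[OF p p0] True \<open>pm p \<noteq> 0\<close>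
        by (auto simp: p'_def)
      from parity_sqrt_mult[OF this m nz(1,3)] show ?thesis
        unfolding f add by auto
    next
      case False
      \<comment> \<open>As \<open>f\<close> is its own reciprocal, \<open>p'\<close> divides it;
        being prime and not dividing \<open>p\<close>, it divides another factor and, both being
        monic irreducible, equals it.\<close>
      have "p' dvd p * prod_mset G"
        by (simp flip: rec_f)
      moreover have prime: "prime_elem p'"
        using p'(1) by (rule field_poly_irreducible_imp_prime)
      moreover have "\<not> p' dvd p"
        using False irreducible_dvd_imp_eq[OF p'(1) p(1)] p'(2) p(2) by auto
      ultimately have "p' dvd prod_mset G"
        by (simp add: prime_elem_dvd_mult_iff)
      then obtain r where r: "r \<in># G" "p' dvd r"
        by (rule prime_elem_dvd_prod_msetE[OF prime])
      have "irreducible r" "lead_coeff r = 1"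
        using less.prems(1)[of r] add r(1) by auto
      then have "r = p'"
        using irreducible_dvd_imp_eq[OF p'(1) _ r(2)] p'(2) by auto
      then obtain H where H: "G = add_mset p' H"
        using r(1) by (metis multi_member_split)
      have "p' * (p * a_reciprocal a (prod_mset H)) = p' * (p * prod_mset H)"
        using rec_f a_nonzero p'(4) by (simp add: H a_reciprocal_mult mult_ac)
      with nz have "a_reciprocal a (prod_mset H) = prod_mset H"
        by simp
      moreover have "pm (prod_mset H) \<noteq> 0" "coeff (prod_mset H) 0 \<noteq> 0"
        using less.prems(5) G0 by (auto simp: f H pm_mult coeff_mult)
      ultimately obtain m where m: "parity_sqrt (prod_mset H) m (size H)"
        using less.hyps[of H "prod_mset H"] less.prems(1) add H by auto
      have "p * p' \<noteq> 0" "prod_mset H \<noteq> 0"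
        using nz by (auto simp: H)
      from parity_sqrt_mult[OF parity_sqrt_reciprocal_pair[OF p0, folded p'_def] m this]
      show ?thesis
        unfolding f add H by (auto simp: mult.assoc)
    qed
  qed
qed

text \<open>The only square roots of \<open>t ^ 2\<close> are \<open>t\<close> and
  \<open>- t\<close>, so it is a square in F_q iff \<open>t\<close> lies in F_q, that is iff
  Frobenius fixes \<open>t\<close>.\<close>

lemma parity_sqrt_imp_even_iff:
  assumes "parity_sqrt f m r" "pm f \<noteq> 0"
  shows "even r \<longleftrightarrow> (\<exists>y. k (y ^ 2) = k ((-1) ^ m * a ^ (m * m)) * pm f)"
proof -
  obtain t where t: "t ^ 2 = k ((-1) ^ m * a ^ (m * m)) * pm f" "t ^ q = (-1) ^ r * t"
    using assms(1) by (auto simp: parity_sqrt_def)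
  have "t \<noteq> 0"
    using t(1) assms(2) a_nonzero by auto
  then have "even r \<longleftrightarrow> t ^ q = t"
    using t(2) one_neq_minus_one by (cases "even r") auto
  also have "\<dots> \<longleftrightarrow> (\<exists>y. k (y ^ 2) = t ^ 2)"
  proof
    assume "t ^ q = t"
    then obtain y where "t = k y"
      by (auto simp: power_q_eq_iff)
    then show "\<exists>y. k (y ^ 2) = t ^ 2"
      by auto
  next
    assume "\<exists>y. k (y ^ 2) = t ^ 2"
    then obtain y where "k y ^ 2 = t ^ 2"
      by auto
    then have "t = k y \<or> t = k (- y)"
      by (auto simp: power2_eq_iff)
    then show "t ^ q = t"
      by (metis k_power_q)
  qed
  finally show ?thesis
    by (simp only: t(1))
qed

end

section \<open>Monic normalization of the factors and passage to an algebraic closure\<close>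

lemma irreducible_smult:
  fixes p :: "'a::field poly"
  assumes "irreducible p" "c \<noteq> 0"
  shows "irreducible (smult c p)"
proof -
  have "is_unit [:c:]"
    using assms(2) by (simp add: is_unit_const_poly_iff dvd_field_iff)
  then have "irreducible ([:c:] * p)"
    using assms(1) by (simp only: irreducible_mult_unit_left)
  then show ?thesis
    by simp
qed

lemma prod_mset_monic_parts:
  fixes F :: "'a::field poly multiset"
  shows "(\<Prod>p\<in>#F. smult (1 / lead_coeff p) p) = smult (1 / lead_coeff (prod_mset F)) (prod_mset F)"
  by (induction F) (simp_all add: lead_coeff_mult mult.commute)

lemma field_embedding_comp:
  assumes "field_embedding g" "field_embedding h"
  shows "field_embedding (\<lambda>x. g (h x))"
  using assms by (simp add: field_embedding_def)

lemma field_embedding_to_ac: "field_embedding to_ac"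
  by (simp add: field_embedding_def)

theorem theorem7:
  fixes a :: "'a::{field, finite}"
    and h :: "'a \<Rightarrow> 'b::field"
    and s :: 'b
    and f :: "'a poly"
    and F :: "'a poly multiset"
    and n r :: nat
  assumes "odd CARD('a)"
    and "a \<noteq> 0"
    and "n \<ge> 1"
    and "field_embedding h"
    and "s ^ 2 = h a"
    and "nontrivial_a_self_reciprocal a f"
    and "degree f = 2 * n"
    and "poly (map_poly h f) s * poly (map_poly h f) (- s) \<noteq> 0"
    and "irreducible_factorization F f"
    and "r = size F"
  shows "even r \<longleftrightarrow>
    (\<exists>y::'a. h (y ^ 2) =
       h ((-1) ^ n * a powi (int n * (int n - 2)))
         * (poly (map_poly h f) s * poly (map_poly h f) (- s)))"
proof -
  \<comment> \<open>The algebraic closure of the given extension supplies the roots of all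
    factors.\<close>
  define k where "k = (\<lambda>x. to_ac (h x))"
  interpret reciprocal_sqrt k "CARD('a)" a "to_ac s"
  proof
    show "field_embedding k"
      unfolding k_def by (rule field_embedding_comp[OF field_embedding_to_ac assms(4)])
    show "to_ac s ^ 2 = k a"
      by (simp add: k_def flip: assms(5))
  qed (use assms in auto)
  have h_0: "h 0 = 0"
    using k_0 by (simp add: k_def)
  have ev_to_ac: "ev p (to_ac x) = to_ac (poly (map_poly h p) x)" for p x
    by (induction p) (simp_all add: map_poly_pCons h_0 k_def)
  define D where "D = poly (map_poly h f) s * poly (map_poly h f) (- s)"
  have pm_f: "pm f = to_ac D"
    using ev_to_ac[of f "- s"] by (simp add: pm_def D_def ev_to_ac)
  then have pm_f_nz: "pm f \<noteq> 0"
    using assms(8) by (simp add: D_def)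
  \<comment> \<open>The given factors may fail to be monic. Dividing by leading coefficients keeps
    their number and irreducibility and, as \<open>f\<close> is monic, their product.\<close>
  define G where "G = image_mset (\<lambda>p. smult (1 / lead_coeff p) p) F"
  have f: "lead_coeff f = 1" "coeff f 0 \<noteq> 0" "a_reciprocal a f = f"
    using assms(6) by (auto simp: nontrivial_a_self_reciprocal_def a_self_reciprocal_def)
  have F: "prod_mset F = f" "\<And>p. p \<in># F \<Longrightarrow> irreducible p"
    using assms(9) by (auto simp: irreducible_factorization_def)
  have "irreducible p \<and> lead_coeff p = 1" if p: "p \<in># G" for p
  proof -
    obtain p' where p': "p' \<in># F" "p = smult (1 / lead_coeff p') p'"
      using p unfolding G_def set_image_mset by blast
    moreover have "irreducible p'"
      using F(2) p'(1) .
    moreover from this have "lead_coeff p' \<noteq> 0"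
      by auto
    ultimately show ?thesis
      by (simp add: irreducible_smult)
  qed
  moreover have "f = prod_mset G"
    unfolding G_def prod_mset_monic_parts F(1) f(1) by simp
  ultimately have "\<exists>m. parity_sqrt f m (size G)"
    using f(2,3) pm_f_nz by (rule parity_sqrt_size)
  then obtain m where m: "parity_sqrt f m (size G)" ..
  then have "degree f = 2 * m"
    unfolding parity_sqrt_def ..
  with assms(7) have "m = n"
    by simp
  have "even r \<longleftrightarrow> (\<exists>y. k (y ^ 2) = k ((-1) ^ n * a ^ (n * n)) * pm f)"
    using parity_sqrt_imp_even_iff[OF m pm_f_nz]
    unfolding \<open>m = n\<close> assms(10) G_def size_image_mset .
  also have "\<dots> \<longleftrightarrow> (\<exists>y. k (y ^ 2) = k ((-1) ^ n * a powi (int n * (int n - 2))) * pm f)"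
    (is "(\<exists>y. k (y ^ 2) = ?A) \<longleftrightarrow> (\<exists>y. k (y ^ 2) = ?B)")
  proof -
    \<comment> \<open>The exponents differ by \<open>2 * n\<close>, so the quotient
      \<open>(a ^ n) ^ 2\<close> can be absorbed into \<open>y ^ 2\<close>.\<close>
    have "a ^ (n * n) = a powi (int n * (int n - 2) + int n * 2)"
      by (simp add: algebra_simps flip: power_int_of_nat)
    also have "\<dots> = a powi (int n * (int n - 2)) * (a ^ n) ^ 2"
      using assms(2) by (simp add: power_int_add power_int_mult)
    finally have A: "?A = ?B * k (a ^ n) ^ 2"
      by simp
    have "k (y ^ 2) = ?A \<longleftrightarrow> k ((y / a ^ n) ^ 2) = ?B" for y
      unfolding A using assms(2) by (simp add: power_divide field_simps)
    moreover have "k (y ^ 2) = ?B \<longleftrightarrow> k ((y * a ^ n) ^ 2) = ?A" for y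
      unfolding A using assms(2) by (simp add: power_mult_distrib)
    ultimately show ?thesis
      by blast
  qed
  also have "\<dots> \<longleftrightarrow> (\<exists>y. h (y ^ 2) = h ((-1) ^ n * a powi (int n * (int n - 2))) * D)"
    unfolding pm_f by (simp only: k_def to_ac_eq_iff flip: to_ac_mult)
  finally show ?thesis
    unfolding D_def .
qed

end
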